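(* Let $X,Y$ be any two compact metric spaces. Assume that $X$ has positive Hausdorff dimension and that $Y$ has finite upper Minkowski dimension, and let $\alpha<\beta$ be two exponents in $(1/2,+\infty)$. Then there is no bi-Lipschitz embedding $\mathrm{HC}(X;(n^{-\alpha}))\hookrightarrow \mathrm{HC}(Y;(n^{-\beta}))$.
   Context: For a compact metric space $(Z,d)$ and an $\ell^2$ sequence $\bar a=(a_n)_{n\ge 1}$ of positive reals, the generalized Hilbert cube $\mathrm{HC}(Z;\bar a)$ is the set $Z^{\mathbb N}$ of sequences $\bar x=(x_n)_{n\geq 1}$ of points of $Z$, endowed with the metric $d_{\bar a}(\bar x,\bar y)=\big(\sum_{n=1}^\infty a_n^2 d(x_n,y_n)^2\big)^{1/2}$. The upper Minkowski dimension of $Z$ is $\limsup_{\varepsilon\to0}\frac{\log N(Z,\varepsilon)}{\log(1/\varepsilon)}$, where $N(Z,\varepsilon)$ is the minimal number of balls of radius $\varepsilon$ needed to cover $Z$. A map $g$ between metric spaces is a bi-Lipschitz embedding if there is $C\ge 1$ with $C^{-1}d(x,x')\le d(g(x),g(x'))\le C\,d(x,x')$ for all $x,x'$. *)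

theory Defs
  imports "HOL-Analysis.Analysis"
begin

section \<open>Hausdorff dimension\<close>

text \<open>Covering sets are required to be bounded because \<open>diameter\<close> is unspecified on unbounded
  sets. Covers are by arbitrary sets of the ambient type; intersecting them with \<open>A\<close> shows that the
  values below depend only on the metric of \<open>A\<close>. The empty set may be used in a cover, so finite
  covers are included.\<close>

definition hausdorff_premeasure :: "real \<Rightarrow> real \<Rightarrow> 'a::metric_space set \<Rightarrow> ennreal" where
  "hausdorff_premeasure s \<delta> A =
     (INF U \<in> {U :: nat \<Rightarrow> 'a set. A \<subseteq> (\<Union>i. U i) \<and> (\<forall>i. bounded (U i) \<and> diameter (U i) \<le> \<delta>)}.
        \<Sum>i. ennreal (diameter (U i) powr s))"

definition hausdorff_measure :: "real \<Rightarrow> 'a::metric_space set \<Rightarrow> ennreal" where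
  "hausdorff_measure s A = (SUP \<delta> \<in> {0<..}. hausdorff_premeasure s \<delta> A)"

text \<open>The exponent \<open>s = 0\<close> is left out since \<open>0 powr 0 = 0\<close>, which would make the \<open>0\<close>-dimensional
  measure of a point vanish; this does not affect the infimum.\<close>

definition hausdorff_dim :: "'a::metric_space set \<Rightarrow> ereal" where
  "hausdorff_dim A = (INF s \<in> {s. 0 < s \<and> hausdorff_measure s A = 0}. ereal s)"


section \<open>Upper Minkowski dimension\<close>

text \<open>Balls are open and centred in \<open>Z\<close>. The minimum exists for totally bounded \<open>Z\<close>, in particular
  for compact \<open>Z\<close>.\<close>

definition covering_number :: "'a::metric_space set \<Rightarrow> real \<Rightarrow> nat" where
  "covering_number Z \<epsilon> =
     (LEAST k. \<exists>C. C \<subseteq> Z \<and> finite C \<and> card C = k \<and> Z \<subseteq> (\<Union>c\<in>C. ball c \<epsilon>))"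

definition upper_minkowski_dim :: "'a::metric_space set \<Rightarrow> ereal" where
  "upper_minkowski_dim Z =
     Limsup (at_right 0) (\<lambda>\<epsilon>. ereal (ln (real (covering_number Z \<epsilon>)) / ln (1 / \<epsilon>)))"


section \<open>Generalized Hilbert cubes\<close>

text \<open>Sequences are indexed from \<open>0\<close>: the value at \<open>n\<close> of a point or of a weight sequence is the
  mathematical entry with index \<open>n + 1\<close>.\<close>

definition HC :: "'a set \<Rightarrow> (nat \<Rightarrow> 'a) set" where
  "HC Z = {x. \<forall>n. x n \<in> Z}"

definition HC_dist :: "(nat \<Rightarrow> real) \<Rightarrow> (nat \<Rightarrow> 'a::metric_space) \<Rightarrow> (nat \<Rightarrow> 'a) \<Rightarrow> real" where
  "HC_dist a x y = sqrt (\<Sum>n. (a n)\<^sup>2 * (dist (x n) (y n))\<^sup>2)"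

lemma HC_dist_summable:
  assumes "bounded Z" "summable (\<lambda>n. (a n)\<^sup>2)" "x \<in> HC Z" "y \<in> HC Z"
  shows "summable (\<lambda>n. (a n)\<^sup>2 * (dist (x n) (y n))\<^sup>2)"
proof (rule summable_comparison_test')
  show "summable (\<lambda>n. (a n)\<^sup>2 * (diameter Z)\<^sup>2)"
    using assms(2) by (rule summable_mult2)
  fix n
  have "dist (x n) (y n) \<le> diameter Z"
    using assms by (auto simp: HC_def intro: diameter_bounded_bound)
  then show "norm ((a n)\<^sup>2 * (dist (x n) (y n))\<^sup>2) \<le> (a n)\<^sup>2 * (diameter Z)\<^sup>2"
    by (auto intro!: mult_left_mono power_mono)
qed

lemma HC_dist_triangle:
  assumes Z: "bounded Z" and a: "summable (\<lambda>n. (a n)\<^sup>2)" "\<And>n. 0 < a n"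
    and xyz: "x \<in> HC Z" "y \<in> HC Z" "z \<in> HC Z"
  shows "HC_dist a x z \<le> HC_dist a x y + HC_dist a y z"
proof -
  let ?L = "\<lambda>x y N. L2_set (\<lambda>n. a n * dist (x n) (y n)) {..<N}"
  have lim: "?L x y \<longlonglongrightarrow> HC_dist a x y" if "x \<in> HC Z" "y \<in> HC Z" for x y
    unfolding HC_dist_def L2_set_def power_mult_distrib
    by (intro tendsto_real_sqrt summable_LIMSEQ HC_dist_summable[OF Z a(1)] that)
  have "?L x z N \<le> ?L x y N + ?L y z N" for N
  proof -
    have "?L x z N \<le> L2_set (\<lambda>n. a n * dist (x n) (y n) + a n * dist (y n) (z n)) {..<N}"
      using a(2) by (intro L2_set_mono)
        (auto simp: less_imp_le dist_triangle simp flip: distrib_left intro!: mult_left_mono)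
    also have "\<dots> \<le> ?L x y N + ?L y z N"
      by (rule L2_set_triangle_ineq)
    finally show ?thesis .
  qed
  then show ?thesis
    using xyz by (intro LIMSEQ_le[OF lim tendsto_add[OF lim lim]]) auto
qed

text \<open>\<open>Metric_space\<close> asks for nonnegativity also outside the carrier, where the series defining
  \<open>HC_dist\<close> may diverge; hence the restriction.\<close>

lemma Metric_space_HC:
  assumes Z: "bounded Z" and a: "summable (\<lambda>n. (a n)\<^sup>2)" "\<And>n. 0 < a n"
  shows "Metric_space (HC Z) (\<lambda>x y. if x \<in> HC Z \<and> y \<in> HC Z then HC_dist a x y else 0)"
proof -
  note summ = HC_dist_summable[OF Z a(1)]
  have "0 \<le> HC_dist a x y" if "x \<in> HC Z" "y \<in> HC Z" for x y
    unfolding HC_dist_def by (intro real_sqrt_ge_zero suminf_nonneg summ that) simp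
  moreover have "HC_dist a x y = HC_dist a y x" for x y
    by (simp add: HC_dist_def dist_commute)
  moreover have "HC_dist a x y = 0 \<longleftrightarrow> x = y" if "x \<in> HC Z" "y \<in> HC Z" for x y
  proof -
    have "a n \<noteq> 0" for n
      using a(2)[of n] by simp
    then show ?thesis
      using suminf_eq_zero_iff[OF summ[OF that]] by (simp add: HC_dist_def fun_eq_iff)
  qed
  ultimately show ?thesis
    using HC_dist_triangle[OF assms] unfolding Metric_space_def by (smt (verit, best))
qed


section \<open>Bi-Lipschitz embeddings\<close>

definition bilipschitz_embedding ::
  "'a set \<Rightarrow> ('a \<Rightarrow> 'a \<Rightarrow> real) \<Rightarrow> 'b set \<Rightarrow> ('b \<Rightarrow> 'b \<Rightarrow> real) \<Rightarrow> ('a \<Rightarrow> 'b) \<Rightarrow> bool" where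
  "bilipschitz_embedding M d M' d' g \<longleftrightarrow>
     g \<in> M \<rightarrow> M' \<and>
     (\<exists>C\<ge>1. \<forall>x\<in>M. \<forall>x'\<in>M. inverse C * d x x' \<le> d' (g x) (g x') \<and> d' (g x) (g x') \<le> C * d x x')"

end

theory Submission
  imports Defs "HOL-Real_Asymp.Real_Asymp"
begin

text \<open>A bi-Lipschitz embedding transports metric entropy, so it is enough to compare the growth of
  the two cubes at small scales.

  Positive Hausdorff dimension gives two distinct points \<open>p\<close>, \<open>q\<close> of \<open>X\<close>, and the words in \<open>p\<close>, \<open>q\<close>
  already make \<open>HC X\<close> large enough. Two words of length \<open>4 * m\<close> that differ in more than \<open>m\<close> places
  lie at squared distance at least a constant times \<open>m powr (1 - 2 * \<alpha>)\<close>, because every weight in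
  use is at least \<open>(4 * m) powr (- \<alpha>)\<close>. A Hamming ball of radius \<open>m\<close> contains at most \<open>10 ^ m\<close> of
  the \<open>16 ^ m\<close> words, so any partition into classes in which words differ in at most \<open>m\<close> places has
  at least \<open>(8 / 5) ^ m\<close> classes (\<open>exponentially_many_classes\<close>).

  In \<open>HC Y\<close>, rounding the first \<open>N\<close> coordinates to a finite set \<open>K\<close> of centres of \<open>r\<close>-balls covering
  \<open>Y\<close>, and forgetting the others, gives at most \<open>card K ^ N\<close> classes; their squared diameter is at
  most a constant times \<open>r\<^sup>2\<close> plus the tail of the squared weights (\<open>HC_finite_partition\<close>). Pulled back
  along the embedding, this partition gives \<open>(8 / 5) ^ m \<le> card K ^ N\<close> as soon as this diameter is
  below the scale of the words (\<open>embedding_entropy_bound\<close>).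

  The tail after \<open>N\<close> is of order \<open>N powr (1 - 2 * \<beta>)\<close>. Since \<open>\<alpha> < \<beta>\<close>, it falls below
  \<open>m powr (1 - 2 * \<alpha>)\<close> already for \<open>N\<close> about \<open>m powr \<gamma>\<close> with some \<open>\<gamma> < 1\<close>; the radius
  \<open>r = m powr (- \<alpha>)\<close> suffices for the other term. Finite upper Minkowski dimension bounds
  \<open>ln (card K)\<close> by a multiple of \<open>ln m\<close>, so \<open>m\<close> would be at most of order \<open>m powr \<gamma> * ln m\<close>, which is
  absurd for large \<open>m\<close>.\<close>

section \<open>Sets of subsets with small pairwise symmetric difference\<close>

text \<open>This is the exponential-moment (Chernoff) bound for the counting measure on \<open>Pow A\<close>: since
  \<open>t \<le> 1\<close>, every \<open>S\<close> that is counted has \<open>t ^ r \<le> t ^ card S\<close>, and the sum of \<open>t ^ card S\<close> over all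
  subsets is the binomial expansion of the right-hand side.\<close>

lemma card_small_subsets_bound:
  fixes t :: real
  assumes A: "finite A" and t: "0 < t" "t \<le> 1"
  shows "real (card {S. S \<subseteq> A \<and> card S \<le> r}) * t ^ r \<le> (1 + t) ^ card A"
proof -
  let ?F = "{S. S \<subseteq> A \<and> card S \<le> r}"
  have "real (card ?F) * t ^ r = (\<Sum>S\<in>?F. t ^ r)"
    by simp
  also have "\<dots> \<le> (\<Sum>S\<in>?F. t ^ card S)"
    using t by (intro sum_mono power_decreasing) auto
  also have "\<dots> \<le> (\<Sum>S\<in>Pow A. t ^ card S)"
    using A t by (intro sum_mono2) auto
  also have "\<dots> = (1 + t) ^ card A"
    using prod_add[OF A, of "\<lambda>_. t" "\<lambda>_. 1"] by (simp add: add.commute)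
  finally show ?thesis .
qed

text \<open>Symmetric difference with a fixed member of a fibre of \<open>\<phi>\<close> maps that fibre injectively into the
  Hamming ball of radius \<open>r\<close> around \<open>{}\<close>. So the fibres, which partition \<open>Pow A\<close>, are no larger than
  that ball.\<close>

lemma card_Pow_le_of_close_fibres:
  assumes A: "finite A"
    and close: "\<And>S T. \<lbrakk>S \<subseteq> A; T \<subseteq> A; \<phi> S = \<phi> T\<rbrakk> \<Longrightarrow> card (sym_diff S T) \<le> r"
  shows "2 ^ card A \<le> card (\<phi> ` Pow A) * card {S. S \<subseteq> A \<and> card S \<le> r}"
proof -
  let ?F = "{S. S \<subseteq> A \<and> card S \<le> r}"
  let ?fib = "\<lambda>c. {S \<in> Pow A. \<phi> S = c}"
  have fib: "card (?fib c) \<le> card ?F" if c: "c \<in> \<phi> ` Pow A" for c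
  proof -
    obtain S where S: "S \<subseteq> A" "\<phi> S = c"
      using c by auto
    have "inj_on (sym_diff S) (?fib c)"
      by (rule inj_onI) blast
    moreover have "sym_diff S ` ?fib c \<subseteq> ?F"
      using S close by blast
    moreover have "finite ?F"
      using A by simp
    ultimately show ?thesis
      by (rule card_inj_on_le)
  qed
  have "2 ^ card A = card (\<Union>c\<in>\<phi> ` Pow A. ?fib c)"
    using A by (subst card_Pow[symmetric]) (auto intro!: arg_cong[where f = card])
  also have "\<dots> \<le> (\<Sum>c\<in>\<phi> ` Pow A. card (?fib c))"
    using A by (intro card_UN_le) auto
  also have "\<dots> \<le> card (\<phi> ` Pow A) * card ?F"
    using sum_bounded_above[of "\<phi> ` Pow A" "\<lambda>c. card (?fib c)", OF fib] by simp
  finally show ?thesis .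
qed

text \<open>With \<open>t = 1/4\<close> the Chernoff bound gives \<open>(5/4) ^ (4 * m) * 4 ^ m = (625/64) ^ m \<le> 10 ^ m\<close> for
  the size of a Hamming ball, against \<open>16 ^ m\<close> words. Any radius that is a fixed proportion below
  one half of the word length would give an exponential bound.\<close>

lemma exponentially_many_classes:
  assumes close: "\<And>S T. \<lbrakk>S \<subseteq> {..<4 * m}; T \<subseteq> {..<4 * m}; \<phi> S = \<phi> T\<rbrakk> \<Longrightarrow> card (sym_diff S T) \<le> m"
  shows "(8 / 5 :: real) ^ m \<le> real (card (\<phi> ` Pow {..<4 * m}))"
proof -
  let ?A = "{..<4 * m}"
  let ?V = "card {S. S \<subseteq> ?A \<and> card S \<le> m}"
  have "real ?V * (1/4) ^ m \<le> (1 + 1/4) ^ (4 * m)"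
    using card_small_subsets_bound[of ?A "1/4" m] by simp
  also have "(1 + 1/4 :: real) ^ (4 * m) = (625/256) ^ m"
    by (subst power_mult) (simp add: power_divide)
  finally have "real ?V / 4 ^ m \<le> (625/256) ^ m"
    by (simp add: power_one_over)
  then have "real ?V \<le> (625/256) ^ m * 4 ^ m"
    by (simp add: pos_divide_le_eq)
  also have "\<dots> = (625/64 :: real) ^ m"
    by (simp flip: power_mult_distrib)
  also have "\<dots> \<le> 10 ^ m"
    by (intro power_mono) auto
  finally have V: "real ?V \<le> 10 ^ m" .
  have "2 ^ (4 * m) \<le> card (\<phi> ` Pow ?A) * ?V"
    using card_Pow_le_of_close_fibres[of ?A \<phi> m] close by simp
  then have "real (2 ^ (4 * m)) \<le> real (card (\<phi> ` Pow ?A) * ?V)"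
    using of_nat_le_iff by blast
  then have "(16::real) ^ m \<le> real (card (\<phi> ` Pow ?A)) * real ?V"
    by (simp add: power_mult)
  also have "\<dots> \<le> real (card (\<phi> ` Pow ?A)) * 10 ^ m"
    using V by (intro mult_left_mono) auto
  finally have "(16::real) ^ m / 10 ^ m \<le> real (card (\<phi> ` Pow ?A))"
    by (simp add: field_simps)
  then show ?thesis
    by (simp flip: power_divide)
qed

section \<open>Distances in generalized Hilbert cubes\<close>

lemma HC_dist_square:
  assumes "bounded Z" "summable (\<lambda>n. (a n)\<^sup>2)" "x \<in> HC Z" "y \<in> HC Z"
  shows "(HC_dist a x y)\<^sup>2 = (\<Sum>n. (a n)\<^sup>2 * (dist (x n) (y n))\<^sup>2)"
  unfolding HC_dist_def
  by (intro real_sqrt_pow2 suminf_nonneg HC_dist_summable[OF assms]) auto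

text \<open>Two points with the same rounded initial coordinates are within \<open>2 * r\<close> of each other in each of
  these coordinates; beyond them only the diameter of \<open>Z\<close> is available, but the weights are small.\<close>

lemma HC_finite_partition:
  fixes Z :: "'a::metric_space set"
  assumes Z: "bounded Z" and a: "summable (\<lambda>n. (a n)\<^sup>2)"
    and K: "Z \<subseteq> (\<Union>c\<in>K. ball c r)"
  obtains \<phi> where "\<phi> ` HC Z \<subseteq> {..<N} \<rightarrow>\<^sub>E K"
    and "\<And>y z. \<lbrakk>y \<in> HC Z; z \<in> HC Z; \<phi> y = \<phi> z\<rbrakk> \<Longrightarrow>
      (HC_dist a y z)\<^sup>2 \<le> (2 * r)\<^sup>2 * (\<Sum>n. (a n)\<^sup>2) + (diameter Z)\<^sup>2 * (\<Sum>n. (a (n + N))\<^sup>2)"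
proof -
  have "\<exists>c. \<forall>y\<in>Z. c y \<in> K \<and> dist (c y) y < r"
    using K by (intro bchoice) fastforce
  then obtain c where c: "\<And>y. y \<in> Z \<Longrightarrow> c y \<in> K" "\<And>y. y \<in> Z \<Longrightarrow> dist (c y) y < r"
    by blast
  define \<phi> where "\<phi> = (\<lambda>y::nat \<Rightarrow> 'a. \<lambda>n\<in>{..<N}. c (y n))"
  show thesis
  proof
    show "\<phi> ` HC Z \<subseteq> {..<N} \<rightarrow>\<^sub>E K"
      using c(1) by (auto simp: \<phi>_def HC_def split: if_splits)
  next
    fix y z assume y: "y \<in> HC Z" and z: "z \<in> HC Z" and eq: "\<phi> y = \<phi> z"
    let ?f = "\<lambda>n. (a n)\<^sup>2 * (dist (y n) (z n))\<^sup>2"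
    have near: "dist (y n) (z n) \<le> 2 * r" if n: "n < N" for n
    proof -
      have "c (y n) = c (z n)"
        using fun_cong[OF eq, of n] n by (simp add: \<phi>_def)
      moreover have "y n \<in> Z" "z n \<in> Z"
        using y z by (auto simp: HC_def)
      ultimately show ?thesis
        using c(2)[of "y n"] c(2)[of "z n"] dist_triangle3[of "y n" "z n" "c (y n)"] by simp
    qed
    have f: "summable ?f"
      by (rule HC_dist_summable[OF Z a y z])
    have tail: "summable (\<lambda>n. (a (n + N))\<^sup>2)"
      using summable_ignore_initial_segment[OF a] .
    have "(\<Sum>n<N. ?f n) \<le> (\<Sum>n<N. (2 * r)\<^sup>2 * (a n)\<^sup>2)"
    proof (intro sum_mono)
      fix n assume "n \<in> {..<N}"
      then have "(dist (y n) (z n))\<^sup>2 \<le> (2 * r)\<^sup>2"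
        using near by (intro power_mono) auto
      then show "?f n \<le> (2 * r)\<^sup>2 * (a n)\<^sup>2"
        by (subst mult.commute) (rule mult_right_mono, auto)
    qed
    also have "\<dots> = (2 * r)\<^sup>2 * (\<Sum>n<N. (a n)\<^sup>2)"
      by (simp add: sum_distrib_left)
    also have "\<dots> \<le> (2 * r)\<^sup>2 * (\<Sum>n. (a n)\<^sup>2)"
      by (intro mult_left_mono sum_le_suminf a) auto
    finally have head: "(\<Sum>n<N. ?f n) \<le> (2 * r)\<^sup>2 * (\<Sum>n. (a n)\<^sup>2)" .
    have "(\<Sum>n. ?f (n + N)) \<le> (\<Sum>n. (diameter Z)\<^sup>2 * (a (n + N))\<^sup>2)"
    proof (intro suminf_le)
      show "summable (\<lambda>n. ?f (n + N))"
        by (rule summable_ignore_initial_segment[OF f])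
      show "summable (\<lambda>n. (diameter Z)\<^sup>2 * (a (n + N))\<^sup>2)"
        by (rule summable_mult[OF tail])
      fix n
      have "dist (y (n + N)) (z (n + N)) \<le> diameter Z"
        using y z Z by (auto simp: HC_def intro: diameter_bounded_bound)
      then have "(dist (y (n + N)) (z (n + N)))\<^sup>2 \<le> (diameter Z)\<^sup>2"
        by (intro power_mono) auto
      then show "?f (n + N) \<le> (diameter Z)\<^sup>2 * (a (n + N))\<^sup>2"
        by (subst mult.commute) (rule mult_right_mono, auto)
    qed
    also have "\<dots> = (diameter Z)\<^sup>2 * (\<Sum>n. (a (n + N))\<^sup>2)"
      by (rule suminf_mult[OF tail])
    finally have "(\<Sum>n. ?f (n + N)) \<le> (diameter Z)\<^sup>2 * (\<Sum>n. (a (n + N))\<^sup>2)" .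
    with head show "(HC_dist a y z)\<^sup>2
        \<le> (2 * r)\<^sup>2 * (\<Sum>n. (a n)\<^sup>2) + (diameter Z)\<^sup>2 * (\<Sum>n. (a (n + N))\<^sup>2)"
      unfolding HC_dist_square[OF Z a y z] suminf_split_initial_segment[OF f, of N] by simp
  qed
qed

lemma HC_dist_two_point_words:
  fixes Z :: "'a::metric_space set" and p q :: 'a
  assumes Z: "bounded Z" and a: "summable (\<lambda>n. (a n)\<^sup>2)" and pq: "p \<in> Z" "q \<in> Z"
    and w: "0 \<le> w" "\<And>n. n < M \<Longrightarrow> w \<le> a n" and ST: "S \<subseteq> {..<M}" "T \<subseteq> {..<M}"
  shows "(w * dist p q)\<^sup>2 * real (card (sym_diff S T))
    \<le> (HC_dist a (\<lambda>n. if n \<in> S then p else q) (\<lambda>n. if n \<in> T then p else q))\<^sup>2"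
proof -
  define x where "x = (\<lambda>S (n::nat). if n \<in> S then p else q)"
  have HC: "x S \<in> HC Z" for S :: "nat set"
    using pq by (simp add: x_def HC_def)
  let ?f = "\<lambda>n. (a n)\<^sup>2 * (dist (x S n) (x T n))\<^sup>2"
  have fin: "finite (sym_diff S T)"
    using ST finite_subset by blast
  have "(w * dist p q)\<^sup>2 * real (card (sym_diff S T)) = (\<Sum>n\<in>sym_diff S T. (w * dist p q)\<^sup>2)"
    by simp
  also have "\<dots> \<le> (\<Sum>n\<in>sym_diff S T. ?f n)"
  proof (intro sum_mono)
    fix n assume n: "n \<in> sym_diff S T"
    then have "dist (x S n) (x T n) = dist p q"
      by (auto simp: x_def dist_commute)
    moreover have "w\<^sup>2 \<le> (a n)\<^sup>2"
      using n ST w by (intro power_mono) auto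
    ultimately show "(w * dist p q)\<^sup>2 \<le> ?f n"
      by (simp add: power_mult_distrib mult_right_mono)
  qed
  also have "\<dots> \<le> (\<Sum>n. ?f n)"
    using fin by (intro sum_le_suminf HC_dist_summable[OF Z a] HC) auto
  also have "\<dots> = (HC_dist a (x S) (x T))\<^sup>2"
    by (rule HC_dist_square[OF Z a HC HC, symmetric])
  finally show ?thesis
    by (simp add: x_def)
qed

section \<open>The entropy inequality forced by an embedding\<close>

text \<open>The classes of \<open>HC_finite_partition\<close>, pulled back to the words in \<open>p\<close> and \<open>q\<close>: the hypothesis
  \<open>small\<close> says that one class is too small to contain the images of two words that differ in more
  than \<open>m\<close> places.\<close>

lemma embedding_entropy_bound:
  fixes X :: "'a::metric_space set" and Y :: "'b::metric_space set"
  assumes X: "bounded X" and Y: "bounded Y"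
    and a: "summable (\<lambda>n. (a n)\<^sup>2)" and b: "summable (\<lambda>n. (b n)\<^sup>2)"
    and g: "g \<in> HC X \<rightarrow> HC Y"
    and expand: "\<And>x x'. \<lbrakk>x \<in> HC X; x' \<in> HC X\<rbrakk> \<Longrightarrow> (HC_dist a x x')\<^sup>2 \<le> L * (HC_dist b (g x) (g x'))\<^sup>2"
    and "0 \<le> L"
    and pq: "p \<in> X" "q \<in> X" "p \<noteq> q"
    and w: "0 < w" "\<And>n. n < 4 * m \<Longrightarrow> w \<le> a n"
    and K: "finite K" "Y \<subseteq> (\<Union>c\<in>K. ball c r)"
    and small: "L * ((2 * r)\<^sup>2 * (\<Sum>n. (b n)\<^sup>2) + (diameter Y)\<^sup>2 * (\<Sum>n. (b (n + N))\<^sup>2))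
      \<le> (w * dist p q)\<^sup>2 * real m"
  shows "(8 / 5 :: real) ^ m \<le> real (card K) ^ N"
proof -
  obtain \<phi> where \<phi>: "\<phi> ` HC Y \<subseteq> {..<N} \<rightarrow>\<^sub>E K"
    and diam: "\<And>y z. \<lbrakk>y \<in> HC Y; z \<in> HC Y; \<phi> y = \<phi> z\<rbrakk> \<Longrightarrow>
      (HC_dist b y z)\<^sup>2 \<le> (2 * r)\<^sup>2 * (\<Sum>n. (b n)\<^sup>2) + (diameter Y)\<^sup>2 * (\<Sum>n. (b (n + N))\<^sup>2)"
    using HC_finite_partition[OF Y b K(2)] by blast
  define x where "x = (\<lambda>S (n::nat). if n \<in> S then p else q)"
  have x: "x S \<in> HC X" for S :: "nat set"
    using pq by (simp add: x_def HC_def)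
  have gx: "g (x S) \<in> HC Y" for S :: "nat set"
    using g x by blast
  have pos: "0 < (w * dist p q)\<^sup>2"
    using w pq by simp
  have close: "card (sym_diff S T) \<le> m"
    if ST: "S \<subseteq> {..<4 * m}" "T \<subseteq> {..<4 * m}" and eq: "\<phi> (g (x S)) = \<phi> (g (x T))" for S T
  proof -
    have "(w * dist p q)\<^sup>2 * real (card (sym_diff S T)) \<le> (HC_dist a (x S) (x T))\<^sup>2"
      using HC_dist_two_point_words[OF X a pq(1,2) _ w(2) ST] w(1) by (simp add: x_def)
    also have "\<dots> \<le> L * (HC_dist b (g (x S)) (g (x T)))\<^sup>2"
      by (rule expand[OF x x])
    also have "\<dots> \<le> (w * dist p q)\<^sup>2 * real m"
      using mult_left_mono[OF diam[OF gx gx eq] \<open>0 \<le> L\<close>] small by linarith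
    finally show ?thesis
      using pos by simp
  qed
  let ?C = "(\<lambda>S. \<phi> (g (x S))) ` Pow {..<4 * m}"
  have "?C \<subseteq> {..<N} \<rightarrow>\<^sub>E K"
    using \<phi> gx by blast
  then have "card ?C \<le> card K ^ N"
    using K(1) card_mono[of "{..<N} \<rightarrow>\<^sub>E K" ?C] by (simp add: card_funcsetE finite_PiE)
  then have "real (card ?C) \<le> real (card K) ^ N"
    using of_nat_mono by fastforce
  with exponentially_many_classes[of m "\<lambda>S. \<phi> (g (x S))", OF close] show ?thesis
    by linarith
qed

section \<open>Dimension hypotheses\<close>

text \<open>The constant sequence with value \<open>A\<close> covers \<open>A\<close> by sets of diameter \<open>0\<close>, and \<open>0 powr s = 0\<close>;
  so the premeasures vanish for every \<open>s\<close> and at every positive scale.\<close>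

lemma hausdorff_dim_le_0_of_subset_singleton:
  assumes "A \<subseteq> {p}"
  shows "hausdorff_dim A \<le> 0"
proof -
  have "A = {} \<or> A = {p}"
    using assms by blast
  then have diam: "diameter A = 0" and bdd: "bounded A"
    by auto
  have zero: "hausdorff_measure s A = 0" for s
  proof -
    have "hausdorff_premeasure s \<delta> A \<le> 0" if "\<delta> > 0" for \<delta>
      unfolding hausdorff_premeasure_def
      using that diam bdd by (intro INF_lower2[where i = "\<lambda>_. A"]) auto
    then show ?thesis
      unfolding hausdorff_measure_def by (intro antisym SUP_least) auto
  qed
  have "hausdorff_dim A \<le> ereal s" if "0 < s" for s
    unfolding hausdorff_dim_def using that zero by (intro INF_lower) auto
  then show ?thesis
    by (meson ereal_dense2 ereal_less(2) leD not_le)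
qed

lemma ex_distinct_points_of_hausdorff_dim_pos:
  assumes "0 < hausdorff_dim A"
  obtains p q where "p \<in> A" "q \<in> A" "p \<noteq> q"
proof -
  have "\<not> A \<subseteq> {p}" for p
    using hausdorff_dim_le_0_of_subset_singleton[of A p] assms by (auto simp: not_le)
  then show thesis
    using that by blast
qed

lemma covering_number_attained:
  fixes Z :: "'a::metric_space set"
  assumes "compact Z" "0 < r"
  obtains C where "finite C" "card C = covering_number Z r" "Z \<subseteq> (\<Union>c\<in>C. ball c r)"
proof -
  have "Z \<subseteq> (\<Union>c\<in>Z. ball c r)"
    using assms(2) by force
  then obtain C where "C \<subseteq> Z" "finite C" "Z \<subseteq> (\<Union>c\<in>C. ball c r)"
    by (rule compactE_image[OF assms(1), rotated]) auto
  then have "\<exists>k C. C \<subseteq> Z \<and> finite C \<and> card C = k \<and> Z \<subseteq> (\<Union>c\<in>C. ball c r)"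
    by blast
  from LeastI_ex[OF this] show thesis
    unfolding covering_number_def[symmetric] using that by blast
qed

lemma ln_covering_number_bound:
  assumes "upper_minkowski_dim Z < \<infinity>"
  obtains D :: real
  where "0 \<le> D" and "eventually (\<lambda>r. ln (real (covering_number Z r)) \<le> D * ln (1 / r)) (at_right 0)"
proof -
  obtain D' where "upper_minkowski_dim Z < ereal D'"
    using ereal_dense2[OF assms] by blast
  moreover define D where "D = max 0 D'"
  ultimately have "0 \<le> D" and "upper_minkowski_dim Z < ereal D"
    by (auto simp: less_max_iff_disj elim: less_le_trans)
  from this(2) have "eventually (\<lambda>r. ln (real (covering_number Z r)) / ln (1 / r) < D) (at_right 0)"
    unfolding upper_minkowski_dim_def by (auto dest: Limsup_lessD)
  moreover have "eventually (\<lambda>r::real. 0 < r \<and> r < 1) (at_right 0)"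
    using eventually_at_right_real[of 0 "1::real"] by simp
  ultimately have "eventually (\<lambda>r. ln (real (covering_number Z r)) \<le> D * ln (1 / r)) (at_right 0)"
    by eventually_elim (simp add: field_simps)
  with \<open>0 \<le> D\<close> show thesis
    by (rule that)
qed

section \<open>Power weights\<close>

lemma summable_power_weights:
  fixes s :: real
  assumes "1 < s"
  shows "summable (\<lambda>n. real (n + 1) powr (- s))"
  using summable_ignore_initial_segment[of "\<lambda>n. real n powr (- s)" 1] assms
  by (simp add: summable_real_powr_iff)

lemma powr_neg_square: "(x powr (- c))\<^sup>2 = x powr (- (2 * c))" for x c :: real
  by (simp add: power2_eq_square flip: powr_add)

text \<open>Splitting the exponent as \<open>s + e\<close> pulls the decay \<open>N powr (- e)\<close> out of the tail and leaves a
  convergent series. The true decay exponent is \<open>s + e - 1\<close>, so the loss is \<open>s - 1\<close>, which can be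
  made arbitrarily small.\<close>

lemma power_weights_tail:
  fixes s e :: real
  assumes s: "1 < s" and e: "0 \<le> e" and N: "1 \<le> N"
  shows "(\<Sum>n. real (n + N + 1) powr (- (s + e)))
    \<le> real N powr (- e) * (\<Sum>n. real (n + 1) powr (- s))"
proof -
  have S: "summable (\<lambda>n. real (n + 1) powr (- s))"
    by (rule summable_power_weights[OF s])
  have "summable (\<lambda>n. real (n + 1) powr (- (s + e)))"
    using s e by (intro summable_power_weights) auto
  then have "summable (\<lambda>n. real (n + N + 1) powr (- (s + e)))"
    by (rule summable_ignore_initial_segment)
  moreover have "real (n + N + 1) powr (- (s + e)) \<le> real N powr (- e) * real (n + 1) powr (- s)" for n
  proof -
    have "real (n + N + 1) powr (- (s + e)) = real (n + N + 1) powr (- e) * real (n + N + 1) powr (- s)"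
      by (simp add: algebra_simps flip: powr_add)
    also have "\<dots> \<le> real N powr (- e) * real (n + 1) powr (- s)"
      using s e N by (intro mult_mono powr_mono2') auto
    finally show ?thesis .
  qed
  ultimately have "(\<Sum>n. real (n + N + 1) powr (- (s + e)))
      \<le> (\<Sum>n. real N powr (- e) * real (n + 1) powr (- s))"
    by (intro suminf_le summable_mult S)
  also have "\<dots> = real N powr (- e) * (\<Sum>n. real (n + 1) powr (- s))"
    by (rule suminf_mult[OF S])
  finally show ?thesis .
qed

section \<open>Non-existence of the embedding\<close>

theorem corollary1p1:
  fixes X :: "'a::metric_space set" and Y :: "'b::metric_space set" and \<alpha> \<beta> :: real
  assumes "compact X" and "compact Y"
    and "0 < hausdorff_dim X" and "upper_minkowski_dim Y < \<infinity>"
    and "1/2 < \<alpha>" and "\<alpha> < \<beta>"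
  shows "\<not> (\<exists>g. bilipschitz_embedding
      (HC X) (HC_dist (\<lambda>n. real (n + 1) powr (- \<alpha>)))
      (HC Y) (HC_dist (\<lambda>n. real (n + 1) powr (- \<beta>))) g)"
proof
  define a where "a = (\<lambda>n. real (n + 1) powr (- \<alpha>))"
  define b where "b = (\<lambda>n. real (n + 1) powr (- \<beta>))"
  assume "\<exists>g. bilipschitz_embedding
      (HC X) (HC_dist (\<lambda>n. real (n + 1) powr (- \<alpha>)))
      (HC Y) (HC_dist (\<lambda>n. real (n + 1) powr (- \<beta>))) g"
  then obtain g C where g: "g \<in> HC X \<rightarrow> HC Y" and "1 \<le> C"
    and lower: "\<And>x x'. \<lbrakk>x \<in> HC X; x' \<in> HC X\<rbrakk> \<Longrightarrow>
      inverse C * HC_dist a x x' \<le> HC_dist b (g x) (g x')"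
    unfolding bilipschitz_embedding_def a_def[symmetric] b_def[symmetric] by blast
  have X: "bounded X" and Y: "bounded Y"
    using assms compact_imp_bounded by auto
  have a2: "summable (\<lambda>n. (a n)\<^sup>2)" and b2: "summable (\<lambda>n. (b n)\<^sup>2)"
    unfolding a_def b_def powr_neg_square using assms by (intro summable_power_weights; simp)+
  obtain p q where pq: "p \<in> X" "q \<in> X" "p \<noteq> q"
    using ex_distinct_points_of_hausdorff_dim_pos[OF assms(3)] .
  have expand: "(HC_dist a x x')\<^sup>2 \<le> C\<^sup>2 * (HC_dist b (g x) (g x'))\<^sup>2"
    if x: "x \<in> HC X" "x' \<in> HC X" for x x'
  proof -
    have "0 \<le> HC_dist a x x'"
      unfolding HC_dist_def by (intro real_sqrt_ge_zero suminf_nonneg HC_dist_summable[OF X a2] x) auto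
    moreover have "HC_dist a x x' \<le> C * HC_dist b (g x) (g x')"
      using lower[OF x] \<open>1 \<le> C\<close> by (simp add: field_simps)
    ultimately show ?thesis
      by (metis power_mono power_mult_distrib)
  qed

  \<comment> \<open>The tail bound needs \<open>s > 1\<close> and \<open>s + e = 2 * \<beta>\<close>, the comparison of scales \<open>e > 2 * \<alpha> - 1\<close>.
    These admit \<open>s\<close> strictly between \<open>1\<close> and \<open>1 + 2 * (\<beta> - \<alpha>)\<close>, and \<open>s\<close> is taken in the middle.
    Likewise \<open>\<gamma>\<close> is the midpoint of \<open>(2 * \<alpha> - 1) / e\<close> and \<open>1\<close>.\<close>
  define s where "s = 1 + \<beta> - \<alpha>"
  define e where "e = \<alpha> + \<beta> - 1"
  define \<gamma> where "\<gamma> = ((2 * \<alpha> - 1) / e + 1) / 2"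
  have s: "1 < s" and e: "0 < e" and se: "s + e = 2 * \<beta>" and e': "2 * \<alpha> - 1 < e"
    using assms by (auto simp: s_def e_def)
  have "\<gamma> * e = (2 * \<alpha> - 1 + e) / 2"
    using e by (simp add: \<gamma>_def field_simps)
  then have \<gamma>: "0 < \<gamma>" "\<gamma> < 1" "2 * \<alpha> - 1 < \<gamma> * e"
    using e e' assms(5) by (auto simp: \<gamma>_def add_pos_pos)
  define N where "N = (\<lambda>m::nat. nat \<lceil>real m powr \<gamma>\<rceil>)"
  define r where "r = (\<lambda>m::nat. real m powr (- \<alpha>))"
  \<comment> \<open>After division by \<open>m powr (1 - 2 * \<alpha>)\<close>, \<open>P\<close> and \<open>Q\<close> are the coefficients of the rounding error
    and of the tail error in \<open>HC Y\<close>, and \<open>R\<close> is the squared separation of the words.\<close>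
  define P where "P = C\<^sup>2 * (4 * (\<Sum>n. (b n)\<^sup>2))"
  define Q where "Q = C\<^sup>2 * ((diameter Y)\<^sup>2 * (\<Sum>n. real (n + 1) powr (- s)))"
  define R where "R = 4 powr (- 2 * \<alpha>) * (dist p q)\<^sup>2"
  have R: "0 < R"
    using pq by (simp add: R_def)
  obtain D where "0 \<le> D" and D: "eventually (\<lambda>r. ln (real (covering_number Y r)) \<le> D * ln (1 / r)) (at_right 0)"
    using ln_covering_number_bound[OF assms(4)] .
  have \<alpha>: "0 < \<alpha>"
    using assms(5) by simp
  have r_lim: "filterlim r (at_right 0) at_top"
    unfolding r_def using \<alpha> by real_asymp
  have ev: "eventually (\<lambda>m::nat. 1 \<le> m) at_top"
    by (rule eventually_ge_at_top)
  have "((\<lambda>m. P * real m powr (- 1) + Q * real m powr (2 * \<alpha> - 1 - \<gamma> * e)) \<longlongrightarrow> 0) at_top"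
    using \<gamma>(3)
    by (intro tendsto_add_zero tendsto_mult_right_zero tendsto_neg_powr filterlim_real_sequentially) auto
  then have ev1: "eventually (\<lambda>m. P * real m powr (- 1) + Q * real m powr (2 * \<alpha> - 1 - \<gamma> * e) < R) at_top"
    using R by (rule order_tendstoD(2))
  have ev2: "eventually (\<lambda>m. (real m powr \<gamma> + 1) * (D * (\<alpha> * ln (real m))) < real m * ln (8 / 5)) at_top"
    using \<gamma>(1,2) by real_asymp
  have "eventually (\<lambda>m::nat. False) at_top"
    using ev ev1 ev2 eventually_compose_filterlim[OF D r_lim]
  proof eventually_elim
    case (elim m)
    have m: "0 < real m"
      using elim(1) by simp
    have N1: "1 \<le> N m"
      using m by (simp add: N_def Suc_le_eq)
    have N_lower: "real m powr \<gamma> \<le> real (N m)" and N_upper: "real (N m) \<le> real m powr \<gamma> + 1"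
      unfolding N_def using powr_ge_zero[of "real m" \<gamma>] by linarith+
    define w where "w = (4 * real m) powr (- \<alpha>)"
    have w: "0 < w" "\<And>n. n < 4 * m \<Longrightarrow> w \<le> a n"
      using m \<alpha> by (auto simp: w_def a_def intro!: powr_mono2')
    have tail: "(\<Sum>n. (b (n + N m))\<^sup>2) \<le> real m powr (- (\<gamma> * e)) * (\<Sum>n. real (n + 1) powr (- s))"
    proof -
      have "(\<Sum>n. (b (n + N m))\<^sup>2) = (\<Sum>n. real (n + N m + 1) powr (- (s + e)))"
        unfolding b_def powr_neg_square se ..
      also have "\<dots> \<le> real (N m) powr (- e) * (\<Sum>n. real (n + 1) powr (- s))"
        using power_weights_tail[OF s _ N1] e by simp
      also have "\<dots> \<le> (real m powr \<gamma>) powr (- e) * (\<Sum>n. real (n + 1) powr (- s))"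
        using N_lower e m
        by (intro mult_right_mono powr_mono2' suminf_nonneg summable_power_weights[OF s]) auto
      finally show ?thesis
        by (simp add: powr_powr)
    qed
    have r2: "(2 * r m)\<^sup>2 = 4 * real m powr (- 2 * \<alpha>)"
      by (simp add: r_def power_mult_distrib powr_neg_square)
    have "C\<^sup>2 * ((2 * r m)\<^sup>2 * (\<Sum>n. (b n)\<^sup>2) + (diameter Y)\<^sup>2 * (\<Sum>n. (b (n + N m))\<^sup>2))
        \<le> C\<^sup>2 * ((2 * r m)\<^sup>2 * (\<Sum>n. (b n)\<^sup>2)
          + (diameter Y)\<^sup>2 * (real m powr (- (\<gamma> * e)) * (\<Sum>n. real (n + 1) powr (- s))))"
      using tail by (intro mult_left_mono add_left_mono) auto
    also have "\<dots> = P * real m powr (- 2 * \<alpha>) + Q * real m powr (- (\<gamma> * e))"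
      unfolding r2 P_def Q_def by (simp add: algebra_simps)
    also have "\<dots> = real m powr (1 - 2 * \<alpha>)
        * (P * real m powr (- 1) + Q * real m powr (2 * \<alpha> - 1 - \<gamma> * e))"
    proof -
      have "real m powr (- 2 * \<alpha>) = real m powr (1 - 2 * \<alpha>) * real m powr (- 1)"
        "real m powr (- (\<gamma> * e)) = real m powr (1 - 2 * \<alpha>) * real m powr (2 * \<alpha> - 1 - \<gamma> * e)"
        unfolding powr_add[symmetric] by simp_all
      then show ?thesis
        by (simp only: distrib_left mult.left_commute)
    qed
    also have "\<dots> \<le> real m powr (1 - 2 * \<alpha>) * R"
      using elim(2) by (intro mult_left_mono) auto
    also have "\<dots> = (w * dist p q)\<^sup>2 * real m"
    proof -
      have "real m powr (1 - 2 * \<alpha>) = real m powr (- 2 * \<alpha>) * real m powr 1"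
        unfolding powr_add[symmetric] by simp
      moreover have "w\<^sup>2 = 4 powr (- 2 * \<alpha>) * real m powr (- 2 * \<alpha>)"
        using m by (simp add: w_def powr_mult power_mult_distrib powr_neg_square)
      ultimately show ?thesis
        using m by (simp add: R_def power_mult_distrib)
    qed
    finally have small: "C\<^sup>2 * ((2 * r m)\<^sup>2 * (\<Sum>n. (b n)\<^sup>2) + (diameter Y)\<^sup>2 * (\<Sum>n. (b (n + N m))\<^sup>2))
        \<le> (w * dist p q)\<^sup>2 * real m" .
    have "0 < r m"
      using m by (simp add: r_def)
    then obtain K where K: "finite K" "card K = covering_number Y (r m)" "Y \<subseteq> (\<Union>c\<in>K. ball c (r m))"
      using covering_number_attained[OF assms(2)] by blast
    have "(8 / 5 :: real) ^ m \<le> real (card K) ^ N m"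
      using embedding_entropy_bound[OF X Y a2 b2 g expand _ pq w K(1,3) small] by simp
    moreover have "0 < card K"
    proof -
      have "g (\<lambda>_. p) 0 \<in> Y"
        using g pq by (auto simp: HC_def)
      then show ?thesis
        using K(1,3) by (auto simp: card_gt_0_iff)
    qed
    ultimately have "ln ((8 / 5 :: real) ^ m) \<le> ln (real (card K) ^ N m)"
      by (intro ln_mono) auto
    then have "real m * ln (8 / 5) \<le> real (N m) * ln (real (card K))"
      using \<open>0 < card K\<close> by (simp add: ln_realpow)
    also have "\<dots> \<le> real (N m) * (D * ln (1 / r m))"
      using elim(4) K(2) by (intro mult_left_mono) auto
    also have "ln (1 / r m) = \<alpha> * ln (real m)"
      using m by (simp add: r_def ln_div ln_powr)
    also have "real (N m) * (D * (\<alpha> * ln (real m))) \<le> (real m powr \<gamma> + 1) * (D * (\<alpha> * ln (real m)))"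
      using N_upper \<alpha> \<open>0 \<le> D\<close> elim(1) by (intro mult_right_mono) auto
    finally show False
      using elim(3) by simp
  qed
  then show False
    by simp
qed

end
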